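(* Let $B^{(n)}$, $Q^{(n)}$, $J$ be associated with $(\mu,\vec w,\vec n)$ as in the context. (1) Assume that $J$ is nonnegative, that $b(B)<\infty$ and $b(B)\notin\mathscr Z(B)$, and let $\lambda\ge b(B)$. Then, for a random walk with Markov matrix $P_{II}=\frac1\lambda\sigma_{II}J\sigma_{II}^{-1}$, $\sigma_{II}=\operatorname{diag}(1/B^{(n)}(\lambda))_{n\ge0}$, the transition probability after $r$ transitions from state $n$ to state $m$ is $$P_{II,nm}^r=\frac{B^{(m)}(\lambda)}{B^{(n)}(\lambda)}\int_\Delta\frac{x^r}{\lambda^r}\,B^{(n)}(x)\,Q^{(m)}(x)\,d\mu(x).$$ (2) Assume that $J$ is nonnegative, that $b(Q)<\infty$, $b(Q)\notin\mathscr Z(Q)$, and that $\lim_{x\to+\infty}Q^{(n)}(x)=+\infty$ (for $n\in\mathbb N_0$), and let $\lambda\ge\max(b(Q),0)$. Then, for a random walk with probability matrix $P_I=\frac1\lambda\sigma_IJ^\top\sigma_I^{-1}$, $\sigma_I=\operatorname{diag}(1/Q^{(n)}(\lambda))_{n\ge0}$, the transition probability after $r$ transitions from state $n$ to state $m$ is $$P_{I,nm}^r=\frac{Q^{(m)}(\lambda)}{Q^{(n)}(\lambda)}\int_\Delta\frac{x^r}{\lambda^r}\,B^{(m)}(x)\,Q^{(n)}(x)\,d\mu(x).$$ Here $P^r_{nm}=(P^r)_{n,m}$.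
   Context: General setting. $\Delta\subset\mathbb R$ is an interval, $\mu$ is a finite Borel measure on $\Delta$ that does not change sign and whose support has infinitely many points, $w_1,\dots,w_p$ are weights on $\Delta$ (real integrable functions that do not change sign on $\Delta$), and $\vec n=(n_1,\dots,n_p)$ is a vector of positive integers, $|\vec n|=n_1+\dots+n_p$. Every $i\in\mathbb N_0$ is written uniquely as $i=q(i)|\vec n|+n_1+\dots+n_{a(i)-1}+r(i)$ with $q(i)\in\mathbb N_0$, $a(i)\in\{1,\dots,p\}$, $0\le r(i)<n_{a(i)}$; put $k(i)=q(i)n_{a(i)}+r(i)$ and $\xi^{(i)}(x)=x^{k(i)}w_{a(i)}(x)$. The pair $(\mu,\vec w)$ is assumed perfect; in particular all leading principal minors of the moment matrix $g_{i,j}=\int_\Delta x^i\xi^{(j)}(x)\,d\mu(x)$ are nonzero. Then: - $B^{(l)}$ is the unique monic polynomial of degree $l$ with $\int_\Delta B^{(l)}\xi^{(j)}\,d\mu=0$ for $0\le j<l$ (type II multiple orthogonal polynomial); - $Q^{(l)}(x)=\sum_{a=1}^pA^{(l)}_a(x) w_a(x)$, with polynomials $A^{(l)}_a$, is the unique real linear combination of $\xi^{(0)},\dots,\xi^{(l)}$ with $\int_\Delta x^iQ^{(l)}(x)\,d\mu(x)=\delta_{i,l}$ for $0\le i\le l$ (type I linear form); the same expression gives its value at points $x$ outside $\Delta$; - the Jacobi matrix $J=(J_{n,m})_{n,m\in\mathbb N_0}$ is defined by $xB^{(n)}(x)=\sum_m J_{n,m}B^{(m)}(x)$. With $N:=\max_a(|\vec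 n|-n_a+1)$ one has $J_{n,n+1}=1$ and $J_{n,m}=0$ unless $n-N\le m\le n+1$. $\mathscr Z(B)\subset\mathbb C$ (resp. $\mathscr Z(Q)\subset\mathbb C$) is the union over $n\in\mathbb N_0$ of the sets of zeros of $B^{(n)}$ (resp. $Q^{(n)}$), and $b(B)$, $b(Q)$ are the suprema of the absolute values of their elements. Under the respective assumptions $P_{II}$ and $P_I$ are stochastic matrices. *)

theory Defs
  imports "HOL-Probability.Probability" "HOL-Computational_Algebra.Polynomial"
begin

section \<open>Measure, weights and perfectness\<close>

text \<open>
  A finite Borel measure on the interval \<open>\<Delta>\<close> that does not change sign is represented as
  \<open>s \<cdot> M\<close> with \<open>M\<close> a finite positive measure on the Borel sets of \<open>\<Delta>\<close> (so \<open>space M = \<Delta>\<close>)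
  and \<open>s = 1\<close> or \<open>s = -1\<close>.
\<close>

definition signed_integral :: "real \<Rightarrow> real measure \<Rightarrow> (real \<Rightarrow> real) \<Rightarrow> real" where
  "signed_integral s M f = s * (\<integral>x. f x \<partial>M)"

definition measure_support :: "real measure \<Rightarrow> real set" where
  "measure_support M = {x. \<forall>U. open U \<and> x \<in> U \<longrightarrow> emeasure M (U \<inter> space M) \<noteq> 0}"

definition constant_sign_on :: "real set \<Rightarrow> (real \<Rightarrow> real) \<Rightarrow> bool" where
  "constant_sign_on S f \<longleftrightarrow> (\<forall>x\<in>S. 0 \<le> f x) \<or> (\<forall>x\<in>S. f x \<le> 0)"

text \<open>
  Weights are indexed by \<open>{1..p}\<close>. A multi-index \<open>\<nu>\<close> is normal if every nontrivial solution
  \<open>(A\<^sub>1, \<dots>, A\<^sub>p)\<close>, \<open>deg A\<^sub>a \<le> \<nu>\<^sub>a - 1\<close>, of the \<open>|\<nu>| - 1\<close> type I orthogonality relations has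
  \<open>deg A\<^sub>a = \<nu>\<^sub>a - 1\<close> for all \<open>a\<close>; the system is perfect if all multi-indices are normal.
  Here \<open>deg A\<^sub>a \<le> -1\<close> means \<open>A\<^sub>a = 0\<close>.
\<close>

definition normal_index ::
  "real \<Rightarrow> real measure \<Rightarrow> nat \<Rightarrow> (nat \<Rightarrow> real \<Rightarrow> real) \<Rightarrow> (nat \<Rightarrow> nat) \<Rightarrow> bool" where
  "normal_index s M p w \<nu> \<longleftrightarrow>
    (\<forall>A :: nat \<Rightarrow> real poly.
       (\<forall>a\<in>{1..p}. A a \<noteq> 0 \<longrightarrow> degree (A a) < \<nu> a) \<and>
       (\<exists>a\<in>{1..p}. A a \<noteq> 0) \<and>
       (\<forall>i. i + 1 < (\<Sum>a=1..p. \<nu> a) \<longrightarrow>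
          signed_integral s M (\<lambda>x. x ^ i * (\<Sum>a=1..p. poly (A a) x * w a x)) = 0)
       \<longrightarrow> (\<forall>a\<in>{1..p}. 0 < \<nu> a \<longrightarrow> A a \<noteq> 0 \<and> degree (A a) + 1 = \<nu> a))"

definition perfect_system ::
  "real \<Rightarrow> real measure \<Rightarrow> nat \<Rightarrow> (nat \<Rightarrow> real \<Rightarrow> real) \<Rightarrow> bool" where
  "perfect_system s M p w \<longleftrightarrow> (\<forall>\<nu>. normal_index s M p w \<nu>)"


section \<open>Multiple orthogonal polynomials on the step line\<close>

text \<open>The triple \<open>(q(i), a(i), r(i))\<close>.\<close>

definition step_triple :: "nat \<Rightarrow> (nat \<Rightarrow> nat) \<Rightarrow> nat \<Rightarrow> nat \<times> nat \<times> nat" where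
  "step_triple p nv i =
    (THE t. case t of (q, a, r) \<Rightarrow>
       a \<in> {1..p} \<and> r < nv a \<and> i = q * (\<Sum>b=1..p. nv b) + (\<Sum>b=1..<a. nv b) + r)"

definition step_a :: "nat \<Rightarrow> (nat \<Rightarrow> nat) \<Rightarrow> nat \<Rightarrow> nat" where
  "step_a p nv i = (case step_triple p nv i of (q, a, r) \<Rightarrow> a)"

definition step_k :: "nat \<Rightarrow> (nat \<Rightarrow> nat) \<Rightarrow> nat \<Rightarrow> nat" where
  "step_k p nv i = (case step_triple p nv i of (q, a, r) \<Rightarrow> q * nv a + r)"

text \<open>
  The weights may be real functions or their extensions to the complex plane, hence the
  polymorphic type.
\<close>

definition xi ::
  "nat \<Rightarrow> (nat \<Rightarrow> nat) \<Rightarrow> (nat \<Rightarrow> 'a \<Rightarrow> 'a) \<Rightarrow> nat \<Rightarrow> 'a \<Rightarrow> 'a::real_normed_field" where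
  "xi p nv w i x = x ^ step_k p nv i * w (step_a p nv i) x"

definition typeII_poly ::
  "real \<Rightarrow> real measure \<Rightarrow> nat \<Rightarrow> (nat \<Rightarrow> nat) \<Rightarrow> (nat \<Rightarrow> real \<Rightarrow> real) \<Rightarrow> nat \<Rightarrow> real poly" where
  "typeII_poly s M p nv w l =
    (THE B. degree B = l \<and> lead_coeff B = 1 \<and>
       (\<forall>j<l. signed_integral s M (\<lambda>x. poly B x * xi p nv w j x) = 0))"

text \<open>
  The coefficients of \<open>Q\<^sup>(\<^sup>l\<^sup>)\<close> with respect to \<open>\<xi>\<^sup>(\<^sup>0\<^sup>), \<dots>, \<xi>\<^sup>(\<^sup>l\<^sup>)\<close>, padded by zeros. They are determined by
  the real weights \<open>w\<close> on \<open>\<Delta>\<close>; the form itself can then be evaluated with any extension \<open>v\<close>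
  of the weights.
\<close>

definition typeI_coeff ::
  "real \<Rightarrow> real measure \<Rightarrow> nat \<Rightarrow> (nat \<Rightarrow> nat) \<Rightarrow> (nat \<Rightarrow> real \<Rightarrow> real) \<Rightarrow> nat \<Rightarrow> nat \<Rightarrow> real" where
  "typeI_coeff s M p nv w l =
    (THE c. (\<forall>j>l. c j = 0) \<and>
       (\<forall>i\<le>l. signed_integral s M (\<lambda>x. x ^ i * (\<Sum>j\<le>l. c j * xi p nv w j x))
          = (if i = l then 1 else 0)))"

definition typeI_form ::
  "real \<Rightarrow> real measure \<Rightarrow> nat \<Rightarrow> (nat \<Rightarrow> nat) \<Rightarrow> (nat \<Rightarrow> real \<Rightarrow> real) \<Rightarrow>
   (nat \<Rightarrow> 'a \<Rightarrow> 'a) \<Rightarrow> nat \<Rightarrow> 'a \<Rightarrow> 'a::real_normed_field" where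
  "typeI_form s M p nv w v l z =
    (\<Sum>j\<le>l. typeI_coeff s M p nv w l j *\<^sub>R xi p nv v j z)"

text \<open>\<open>x B\<^sub>n = \<Sum>\<^sub>m J\<^sub>n\<^sub>m B\<^sub>m\<close>, an expansion in finitely many \<open>B\<^sub>m\<close> for each \<open>n\<close>.\<close>

definition jacobi_matrix :: "(nat \<Rightarrow> real poly) \<Rightarrow> nat \<Rightarrow> nat \<Rightarrow> real" where
  "jacobi_matrix B =
    (THE J. \<forall>n. finite {m. J n m \<noteq> 0} \<and>
       [:0, 1:] * B n = (\<Sum>m | J n m \<noteq> 0. smult (J n m) (B m)))"


section \<open>Zeros\<close>

definition zeros_typeII :: "(nat \<Rightarrow> real poly) \<Rightarrow> complex set" where
  "zeros_typeII B = (\<Union>n. {z. poly (map_poly complex_of_real (B n)) z = 0})"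

definition zeros_typeI :: "(nat \<Rightarrow> complex \<Rightarrow> complex) \<Rightarrow> complex set" where
  "zeros_typeI Q = (\<Union>n. {z. Q n z = 0})"

text \<open>Extended real, so that \<open>\<infinity>\<close> is possible and the supremum over no zeros is \<open>-\<infinity>\<close>.\<close>

definition zero_bound :: "complex set \<Rightarrow> ereal" where
  "zero_bound Z = (SUP z\<in>Z. ereal (cmod z))"

definition zero_bound_attained :: "complex set \<Rightarrow> bool" where
  "zero_bound_attained Z \<longleftrightarrow> (\<exists>b::real. ereal b = zero_bound Z \<and> complex_of_real b \<in> Z)"


section \<open>Infinite matrices and random walks on the natural numbers\<close>

type_synonym imat = "nat \<Rightarrow> nat \<Rightarrow> real"

text \<open>In all products used here the sum has only finitely many nonzero terms.\<close>

definition imat_mult :: "imat \<Rightarrow> imat \<Rightarrow> imat" where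
  "imat_mult A B n m = (\<Sum>k. A n k * B k m)"

definition imat_diag :: "(nat \<Rightarrow> real) \<Rightarrow> imat" where
  "imat_diag d n m = (if n = m then d n else 0)"

definition imat_scale :: "real \<Rightarrow> imat \<Rightarrow> imat" where
  "imat_scale c A n m = c * A n m"

definition imat_transpose :: "imat \<Rightarrow> imat" where
  "imat_transpose A n m = A m n"

primrec imat_power :: "imat \<Rightarrow> nat \<Rightarrow> imat" where
  "imat_power A 0 = imat_diag (\<lambda>_. 1)"
| "imat_power A (Suc r) = imat_mult (imat_power A r) A"

text \<open>\<open>\<lambda>\<^sup>-\<^sup>1 \<sigma> A \<sigma>\<^sup>-\<^sup>1\<close> for \<open>\<sigma> = diag(1/d\<^sub>n)\<close>, whose inverse is \<open>diag(d\<^sub>n)\<close>.\<close>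

definition markov_normalization :: "real \<Rightarrow> (nat \<Rightarrow> real) \<Rightarrow> imat \<Rightarrow> imat" where
  "markov_normalization lam d A =
    imat_scale (1 / lam) (imat_mult (imat_mult (imat_diag (\<lambda>n. 1 / d n)) A) (imat_diag d))"

text \<open>
  A random walk is given by the distribution \<open>K n\<close> of the next state when the current state
  is \<open>n\<close>; \<open>walk_distribution K n r\<close> is the distribution after \<open>r\<close> transitions from \<open>n\<close>.
\<close>

definition has_markov_matrix :: "(nat \<Rightarrow> nat pmf) \<Rightarrow> imat \<Rightarrow> bool" where
  "has_markov_matrix K P \<longleftrightarrow> (\<forall>n m. pmf (K n) m = P n m)"

primrec walk_distribution :: "(nat \<Rightarrow> nat pmf) \<Rightarrow> nat \<Rightarrow> nat \<Rightarrow> nat pmf" where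
  "walk_distribution K n 0 = return_pmf n"
| "walk_distribution K n (Suc r) = bind_pmf (walk_distribution K n r) K"

end

theory Submission
  imports Defs "Jordan_Normal_Form.Determinant"
begin

text \<open>
  Perfectness makes the leading sections of the moment matrix invertible, so \<open>B\<^sup>(\<^sup>n\<^sup>)\<close> and \<open>Q\<^sup>(\<^sup>m\<^sup>)\<close> exist,
  are unique, and are biorthogonal: \<open>\<integral> B\<^sup>(\<^sup>n\<^sup>) Q\<^sup>(\<^sup>m\<^sup>) d\<mu> = \<delta>\<^sub>n\<^sub>m\<close>. Hence every polynomial expands as
  \<open>q = \<Sum>\<^sub>m (\<integral> q Q\<^sup>(\<^sup>m\<^sup>) d\<mu>) B\<^sup>(\<^sup>m\<^sup>)\<close>, and iterating multiplication by \<open>x\<close> gives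
  \<open>(J\<^sup>r)\<^sub>n\<^sub>m = \<integral> x\<^sup>r B\<^sup>(\<^sup>n\<^sup>) Q\<^sup>(\<^sup>m\<^sup>) d\<mu>\<close>. Conjugation by a diagonal matrix without zero entries only
  rescales these numbers, and the assumption on the zeros makes the values at \<open>\<lambda>\<close> nonzero.
\<close>

section \<open>Square linear systems\<close>

text \<open>A trivial kernel forces a nonzero determinant, hence a two-sided inverse. Index
  functions and plain sums in the statement keep matrix types out of everything that
  follows.\<close>

lemma inverse_of_trivial_kernel:
  fixes g :: "nat \<Rightarrow> nat \<Rightarrow> 'a::field"
  assumes ker: "\<And>c j. (\<forall>i<n. (\<Sum>j<n. g i j * c j) = 0) \<Longrightarrow> j < n \<Longrightarrow> c j = 0"
  obtains h where
    "\<forall>i<n. \<forall>j<n. (\<Sum>k<n. g i k * h k j) = of_bool (i = j)"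
    "\<forall>i<n. \<forall>j<n. (\<Sum>k<n. h i k * g k j) = of_bool (i = j)"
proof -
  define A where "A = mat n n (\<lambda>(i, j). g i j)"
  have A: "A \<in> carrier_mat n n"
    by (simp add: A_def)
  have "det A \<noteq> 0"
  proof
    assume "det A = 0"
    then obtain v where v: "v \<in> carrier_vec n" "v \<noteq> 0\<^sub>v n" "A *\<^sub>v v = 0\<^sub>v n"
      using det_0_iff_vec_prod_zero_field[OF A] by blast
    have "(\<Sum>j<n. g i j * vec_index v j) = 0" if "i < n" for i
    proof -
      have "vec_index (A *\<^sub>v v) i = (\<Sum>j<n. g i j * vec_index v j)"
        using that v(1) by (simp add: A_def scalar_prod_def lessThan_atLeast0)
      then show ?thesis
        using v(3) that by simp
    qed
    then have "vec_index v j = 0" if "j < n" for j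
      using ker[of "vec_index v"] that by blast
    then have "v = 0\<^sub>v n"
      using v(1) by (intro eq_vecI) auto
    then show False
      using v(2) by simp
  qed
  \<comment> \<open>\<open>undefined\<close> fills a slot of \<open>ring_mat\<close> that carries no
    information; a unit of this ring has a two-sided inverse.\<close>
  from det_non_zero_imp_unit[OF A this, unfolded Units_def, of undefined]
  obtain H where H: "H \<in> carrier_mat n n" "H * A = 1\<^sub>m n" "A * H = 1\<^sub>m n"
    by (auto simp: ring_mat_def)
  have AH: "(\<Sum>k<n. g i k * H $$ (k, j)) = of_bool (i = j)" if "i < n" "j < n" for i j
  proof -
    have "(\<Sum>k<n. g i k * H $$ (k, j)) = (A * H) $$ (i, j)"
      using that H(1) by (simp add: A_def scalar_prod_def lessThan_atLeast0)
    also have "\<dots> = of_bool (i = j)"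
      using that by (simp add: H(3))
    finally show ?thesis .
  qed
  have HA: "(\<Sum>k<n. H $$ (i, k) * g k j) = of_bool (i = j)" if "i < n" "j < n" for i j
  proof -
    have "(\<Sum>k<n. H $$ (i, k) * g k j) = (H * A) $$ (i, j)"
      using that H(1) by (simp add: A_def scalar_prod_def lessThan_atLeast0)
    also have "\<dots> = of_bool (i = j)"
      using that by (simp add: H(2))
    finally show ?thesis .
  qed
  show thesis
    by (rule that[of "\<lambda>i j. H $$ (i, j)"]) (use AH HA in auto)
qed

text \<open>Interchanging the two sums contracts \<open>g\<close> with \<open>h\<close> to the
  Kronecker delta. With \<open>g\<close> and \<open>h\<close> exchanged, the same identity recovers
  a solution from its right-hand side and so gives uniqueness.\<close>

lemma solve_of_right_inverse:
  fixes g h :: "nat \<Rightarrow> nat \<Rightarrow> 'a::comm_ring_1"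
  assumes "\<And>i j. i < n \<Longrightarrow> j < n \<Longrightarrow> (\<Sum>k<n. g i k * h k j) = of_bool (i = j)" and "i < n"
  shows "(\<Sum>k<n. g i k * (\<Sum>j<n. h k j * y j)) = y i"
proof -
  have "(\<Sum>k<n. g i k * (\<Sum>j<n. h k j * y j)) = (\<Sum>j<n. (\<Sum>k<n. g i k * h k j) * y j)"
    unfolding sum_distrib_left sum_distrib_right
    by (subst sum.swap) (simp add: mult.assoc)
  also have "\<dots> = (\<Sum>j<n. if j = i then y j else 0)"
    using assms by (intro sum.cong) auto
  finally show ?thesis
    using \<open>i < n\<close> by simp
qed


section \<open>The step line\<close>

locale step_line =
  fixes p :: nat and nv :: "nat \<Rightarrow> nat"
  assumes p_pos: "1 \<le> p" and nv_pos: "a \<in> {1..p} \<Longrightarrow> 1 \<le> nv a"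
begin

text \<open>This is the inverse of i \<mapsto> (a(i), k(i)): since r < \<open>nv a\<close>, dividing
  k = q \<open>nv a\<close> + r by \<open>nv a\<close> recovers q and r.\<close>

definition step_index :: "nat \<Rightarrow> nat \<Rightarrow> nat" where
  "step_index a k = (k div nv a) * (\<Sum>b=1..p. nv b) + (\<Sum>b=1..<a. nv b) + k mod nv a"

lemma partial_sum_less:
  assumes "a \<in> {1..p}" "r < nv a" "a < c" "c \<le> Suc p"
  shows "(\<Sum>b=1..<a. nv b) + r < (\<Sum>b=1..<c. nv b)"
proof -
  have "(\<Sum>b=1..<a. nv b) + r < (\<Sum>b=1..<Suc a. nv b)"
    using assms by simp
  also have "\<dots> \<le> (\<Sum>b=1..<c. nv b)"
    using assms by (intro sum_mono2) auto
  finally show ?thesis .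
qed

lemma partial_sum_less_total:
  assumes "a \<in> {1..p}" "r < nv a"
  shows "(\<Sum>b=1..<a. nv b) + r < (\<Sum>b=1..p. nv b)"
  using partial_sum_less[OF assms, of "Suc p"] assms(1) atLeastLessThanSuc_atLeastAtMost[of 1 p]
  by (simp del: sum.op_ivl_Suc)

text \<open>Offsets within a period are smaller than the period, so Euclidean division fixes q. The
  blocks inside a period are disjoint, which fixes a and then r.\<close>

lemma step_triple_unique:
  assumes "a \<in> {1..p}" "r < nv a" "a' \<in> {1..p}" "r' < nv a'"
    and eq: "q * (\<Sum>b=1..p. nv b) + (\<Sum>b=1..<a. nv b) + r =
      q' * (\<Sum>b=1..p. nv b) + (\<Sum>b=1..<a'. nv b) + r'"
  shows "(q, a, r) = (q', a', r')"
proof -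
  define N where "N = (\<Sum>b=1..p. nv b)"
  define t where "t = (\<Sum>b=1..<a. nv b) + r"
  define t' where "t' = (\<Sum>b=1..<a'. nv b) + r'"
  have less: "t < N" "t' < N"
    using partial_sum_less_total assms by (auto simp: t_def t'_def N_def)
  have eq': "q * N + t = q' * N + t'"
    using eq by (simp add: N_def t_def t'_def)
  have "(q * N + t) div N = q" "(q' * N + t') div N = q'"
    using less by simp_all
  then have q: "q = q'"
    using eq' by simp
  then have t: "t = t'"
    using eq' by simp
  have "a = a'"
  proof (rule ccontr)
    assume "a \<noteq> a'"
    then consider "a < a'" | "a' < a" by linarith
    then show False
      using partial_sum_less[of a r a'] partial_sum_less[of a' r' a] t assms
      by cases (auto simp: t_def t'_def)
  qed
  then show ?thesis
    using q t by (simp add: t_def t'_def)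
qed

lemma step_triple_eqI:
  assumes "a \<in> {1..p}" "r < nv a" "i = q * (\<Sum>b=1..p. nv b) + (\<Sum>b=1..<a. nv b) + r"
  shows "step_triple p nv i = (q, a, r)"
  unfolding step_triple_def
proof (rule the_equality)
  fix t
  assume t: "case t of (q, a, r) \<Rightarrow> a \<in> {1..p} \<and> r < nv a \<and>
    i = q * (\<Sum>b=1..p. nv b) + (\<Sum>b=1..<a. nv b) + r"
  obtain q' a' r' where "t = (q', a', r')"
    by (rule prod_cases3)
  with t have "a' \<in> {1..p}" "r' < nv a'"
    "q' * (\<Sum>b=1..p. nv b) + (\<Sum>b=1..<a'. nv b) + r' = q * (\<Sum>b=1..p. nv b) + (\<Sum>b=1..<a. nv b) + r"
    using assms(3) by auto
  then show "t = (q, a, r)"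
    unfolding \<open>t = (q', a', r')\<close> using assms(1,2) by (intro step_triple_unique)
qed (use assms in simp)

lemma step_index_surj: "\<exists>a k. a \<in> {1..p} \<and> i = step_index a k"
proof -
  define N where "N = (\<Sum>b=1..p. nv b)"
  have "1 \<le> nv 1" "nv 1 \<le> N"
    using nv_pos[of 1] p_pos by (auto simp: N_def intro!: member_le_sum)
  then have N: "i mod N < N"
    by simp
  \<comment> \<open>The block holding the residue is the first one whose cumulative length exceeds
    it; minimality gives the matching lower bound.\<close>
  define a where "a = (LEAST c. i mod N < (\<Sum>b=1..c. nv b))"
  have less: "i mod N < (\<Sum>b=1..a. nv b)"
    unfolding a_def by (rule LeastI[of _ p]) (use N in \<open>simp add: N_def\<close>)
  have "a \<le> p"
    unfolding a_def by (rule Least_le) (use N in \<open>simp add: N_def\<close>)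
  have "a \<noteq> 0"
    using less by (intro notI) simp
  have "\<not> i mod N < (\<Sum>b=1..a - 1. nv b)"
    using \<open>a \<noteq> 0\<close> not_less_Least[of "a - 1" "\<lambda>c. i mod N < (\<Sum>b=1..c. nv b)"]
    unfolding a_def[symmetric] by simp
  moreover have "{1..a - 1} = {1..<a}"
    using \<open>a \<noteq> 0\<close> by auto
  ultimately have ge: "(\<Sum>b=1..<a. nv b) \<le> i mod N"
    by simp
  have "{1..a} = insert a {1..<a}"
    using \<open>a \<noteq> 0\<close> by auto
  then have "i mod N < (\<Sum>b=1..<a. nv b) + nv a"
    using less by simp
  then obtain r where r: "i mod N = (\<Sum>b=1..<a. nv b) + r" "r < nv a"
    using ge by (metis le_Suc_ex nat_add_left_cancel_less)
  have "i = step_index a (i div N * nv a + r)"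
    using r div_mult_mod_eq[of i N] by (simp add: step_index_def N_def)
  then show ?thesis
    using \<open>a \<noteq> 0\<close> \<open>a \<le> p\<close> by (intro exI[of _ a] exI[of _ "i div N * nv a + r"]) auto
qed

lemma step_index_inverse:
  assumes "a \<in> {1..p}"
  shows "step_a p nv (step_index a k) = a" "step_k p nv (step_index a k) = k"
proof -
  have "step_triple p nv (step_index a k) = (k div nv a, a, k mod nv a)"
    using nv_pos[OF assms] assms by (intro step_triple_eqI) (auto simp: step_index_def)
  then show "step_a p nv (step_index a k) = a" "step_k p nv (step_index a k) = k"
    by (simp_all add: step_a_def step_k_def)
qed

lemma step_a_mem: "step_a p nv i \<in> {1..p}"
  using step_index_surj[of i] step_index_inverse by auto

lemma step_index_step: "step_index (step_a p nv i) (step_k p nv i) = i"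
  using step_index_surj[of i] step_index_inverse by auto

lemma step_eqD:
  "step_a p nv i = step_a p nv j \<Longrightarrow> step_k p nv i = step_k p nv j \<Longrightarrow> i = j"
  by (metis step_index_step)

text \<open>In the same period only the remainders differ; otherwise the index for \<open>k\<close>
  lies below the start of the period of \<open>l\<close>.\<close>

lemma step_index_less:
  assumes "a \<in> {1..p}" "k < l"
  shows "step_index a k < step_index a l"
proof (cases "k div nv a = l div nv a")
  case True
  then have "k mod nv a < l mod nv a"
    using assms(2) by (metis div_mult_mod_eq nat_add_left_cancel_less)
  then show ?thesis
    using True by (simp add: step_index_def)
next
  case False
  then have div: "k div nv a + 1 \<le> l div nv a"
    using assms(2) div_le_mono[of k l "nv a"] by simp
  have "(\<Sum>b=1..<a. nv b) + k mod nv a < (\<Sum>b=1..p. nv b)"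
    using nv_pos[OF assms(1)] assms(1) by (intro partial_sum_less_total) auto
  then have "step_index a k < (k div nv a + 1) * (\<Sum>b=1..p. nv b)"
    by (simp add: step_index_def)
  also have "\<dots> \<le> (l div nv a) * (\<Sum>b=1..p. nv b)"
    using div by (rule mult_le_mono1)
  finally show ?thesis
    by (simp add: step_index_def)
qed

text \<open>The powers of one weight enter in increasing order without gaps, so all exponents up to
  k(j) have occurred by index \<open>j\<close>. This bounds the degrees of the polynomial factors in
  combinations of the first \<open>n\<close> forms.\<close>

lemma step_k_less_card:
  assumes "j < n"
  shows "step_k p nv j < card {i. i < n \<and> step_a p nv i = step_a p nv j}"
proof -
  let ?a = "step_a p nv j"
  have "step_index ?a ` {..step_k p nv j} \<subseteq> {i. i < n \<and> step_a p nv i = ?a}"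
  proof (intro image_subsetI CollectI)
    fix k assume "k \<in> {..step_k p nv j}"
    then have "step_index ?a k \<le> j"
      using step_index_less[OF step_a_mem, of k "step_k p nv j" j] step_index_step[of j]
      by (cases "k = step_k p nv j") auto
    then show "step_index ?a k < n \<and> step_a p nv (step_index ?a k) = ?a"
      using assms step_index_inverse(1)[OF step_a_mem] by simp
  qed
  moreover have "inj_on (step_index ?a) {..step_k p nv j}"
    by (rule inj_on_inverseI[where g = "step_k p nv"]) (rule step_index_inverse(2)[OF step_a_mem])
  ultimately have "card {..step_k p nv j} \<le> card {i. i < n \<and> step_a p nv i = ?a}"
    by (intro card_inj_on_le) auto
  then show ?thesis
    by simp
qed

end


section \<open>Expansions with respect to a biorthogonal family\<close>

text \<open>\<open>L q m\<close> stands for \<open>\<integral> q Q\<^sup>(\<^sup>m\<^sup>) d\<mu>\<close>.\<close>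

locale biorthogonal =
  fixes B :: "nat \<Rightarrow> real poly" and L :: "real poly \<Rightarrow> nat \<Rightarrow> real"
  assumes degree_B: "degree (B n) = n" and monic_B: "lead_coeff (B n) = 1"
    and L_add: "L (f + g) m = L f m + L g m"
    and L_smult: "L (Polynomial.smult c f) m = c * L f m"
    and L_B: "L (B n) m = of_bool (n = m)"
begin

lemma L_0: "L 0 m = 0"
  using L_smult[of 0 0 m] by simp

lemma L_sum: "L (\<Sum>i\<in>I. f i) m = (\<Sum>i\<in>I. L (f i) m)"
  by (induction I rule: infinite_finite_induct) (simp_all add: L_0 L_add)

text \<open>Subtracting a multiple of the monic \<open>B d\<close> lowers the degree, which yields
  some expansion by induction; applying \<open>L\<close> then identifies its coefficients.\<close>

lemma expansion: "degree q < d \<Longrightarrow> q = (\<Sum>m<d. Polynomial.smult (L q m) (B m))"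
proof (induction d arbitrary: q)
  case 0
  then show ?case by simp
next
  case (Suc d)
  define c where "c = coeff q d"
  define f where "f = q - Polynomial.smult c (B d)"
  have q: "q = f + Polynomial.smult c (B d)"
    by (simp add: f_def)
  \<comment> \<open>For \<open>d = 0\<close> the bound \<open>degree f < d\<close> is impossible
    even though \<open>f\<close> vanishes, hence the separate case with
    \<open>B 0 = 1\<close>.\<close>
  have "\<exists>e. f = (\<Sum>m<d. Polynomial.smult (e m) (B m))"
  proof (cases "d = 0")
    case True
    have "B 0 = 1"
      using degree_B[of 0] monic_B[of 0] by (metis degree_0_id one_pCons)
    moreover have "q = [:c:]"
      using Suc.prems True by (metis c_def degree_0_id less_Suc0)
    ultimately show ?thesis
      using True by (simp add: f_def one_pCons)
  next
    case False
    have "coeff f i = 0" if "d \<le> i" for i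
    proof (cases "i = d")
      case True
      then show ?thesis
        using monic_B[of d] by (simp add: f_def c_def degree_B)
    next
      case False
      then show ?thesis
        using that Suc.prems by (simp add: f_def coeff_eq_0 degree_B)
    qed
    then have "degree f < d"
      using False by (metis leading_coeff_0_iff degree_0 not_le not_gr_zero)
    then show ?thesis
      using Suc.IH by blast
  qed
  then obtain e where e: "f = (\<Sum>m<d. Polynomial.smult (e m) (B m))" ..
  have "L f m = (if m < d then e m else 0)" for m
    unfolding e L_sum L_smult L_B by (simp add: of_bool_def if_distrib[of "\<lambda>x. _ * x"] cong: if_cong)
  then have "L q m = (if m < d then e m else if m = d then c else 0)" for m
    unfolding q L_add L_smult L_B by simp
  then show ?case
    by (subst q, subst e) simp
qed

text \<open>Terms with \<open>L q m = 0\<close> can be added or dropped. Taking \<open>S\<close> to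
  be the support itself matches the index set in \<open>jacobi_matrix\<close>.\<close>

lemma expansion_sum:
  assumes "finite S" "{m. L q m \<noteq> 0} \<subseteq> S"
  shows "q = (\<Sum>m\<in>S. Polynomial.smult (L q m) (B m))"
proof -
  obtain d where d: "degree q < d" "S \<subseteq> {..<d}"
  proof -
    obtain e where "S \<subseteq> {..<e}"
      using finite_nat_iff_bounded assms(1) by blast
    then show thesis
      by (intro that[of "max e (Suc (degree q))"]) auto
  qed
  have "q = (\<Sum>m<d. Polynomial.smult (L q m) (B m))"
    by (rule expansion) fact
  also have "\<dots> = (\<Sum>m\<in>S. Polynomial.smult (L q m) (B m))"
    using d assms by (intro sum.mono_neutral_right) auto
  finally show ?thesis .
qed

lemma finite_L: "finite {m. L q m \<noteq> 0}"
proof -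
  define d where "d = Suc (degree q)"
  have "L q m = 0" if "m \<ge> d" for m
  proof -
    have "L q m = L (\<Sum>m<d. Polynomial.smult (L q m) (B m)) m"
      by (subst expansion[of q d]) (simp_all add: d_def)
    also have "\<dots> = 0"
      using that by (simp add: L_sum L_smult L_B)
    finally show ?thesis .
  qed
  then have "{m. L q m \<noteq> 0} \<subseteq> {..<d}"
    by (auto simp: not_less[symmetric])
  then show ?thesis
    by (rule finite_subset) simp
qed

text \<open>Applying \<open>L\<close> to any admissible expansion of x \<open>B n\<close> returns
  its coefficients, so the definite description denotes the matrix of the integrals \<integral> x B
  Q.\<close>

lemma jacobi_matrix_eq: "jacobi_matrix B = (\<lambda>n m. L ([:0, 1:] * B n) m)"
  unfolding jacobi_matrix_def
proof (rule the_equality)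
  show "\<forall>n. finite {m. L ([:0, 1:] * B n) m \<noteq> 0} \<and>
      [:0, 1:] * B n =
        (\<Sum>m | L ([:0, 1:] * B n) m \<noteq> 0. Polynomial.smult (L ([:0, 1:] * B n) m) (B m))"
    using finite_L expansion_sum by blast
next
  fix J
  assume J: "\<forall>n. finite {m. J n m \<noteq> 0} \<and>
      [:0, 1:] * B n = (\<Sum>m | J n m \<noteq> 0. Polynomial.smult (J n m) (B m))"
  have "L ([:0, 1:] * B n) m = J n m" for n m
  proof -
    have "L ([:0, 1:] * B n) m = (\<Sum>k | J n k \<noteq> 0. J n k * of_bool (k = m))"
      using J by (simp only: L_sum L_smult L_B)
    also have "\<dots> = (\<Sum>k | J n k \<noteq> 0. if k = m then J n k else 0)"
      by (intro sum.cong) auto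
    also have "\<dots> = J n m"
      using J by (simp add: sum.delta)
    finally show ?thesis .
  qed
  then show "J = (\<lambda>n m. L ([:0, 1:] * B n) m)"
    by (simp add: fun_eq_iff)
qed

text \<open>Expand \<open>q\<close> first, then multiply each \<open>B k\<close> by
  \<open>f\<close>. The finite sum is written as a series to fit \<open>imat_mult\<close>; suitable
  choices of \<open>f\<close> and \<open>q\<close> give the recursions for powers of J and of its
  transpose.\<close>

lemma L_mult_sums: "(\<lambda>k. L q k * L (f * B k) m) sums L (f * q) m"
proof -
  have "L (f * q) m = L (f * (\<Sum>k | L q k \<noteq> 0. Polynomial.smult (L q k) (B k))) m"
    by (subst expansion_sum[OF finite_L[of q] subset_refl]) simp
  also have "\<dots> = (\<Sum>k | L q k \<noteq> 0. L q k * L (f * B k) m)"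
    by (simp add: sum_distrib_left L_sum L_smult)
  finally show ?thesis
    using sums_finite[of "{k. L q k \<noteq> 0}" "\<lambda>k. L q k * L (f * B k) m"] finite_L[of q] by simp
qed

end


section \<open>Matrix powers and random walks\<close>

text \<open>A diagonal factor leaves at most one nonzero term in each series of the product.\<close>

lemma markov_normalization_eq:
  "markov_normalization lam d A n m = d m / d n * A n m / lam"
proof -
  have "imat_mult (imat_diag (\<lambda>n. 1 / d n)) A n k = A n k / d n" for k
    unfolding imat_mult_def imat_diag_def by (subst suminf_finite[of "{n}"]) auto
  then have "imat_mult (imat_mult (imat_diag (\<lambda>n. 1 / d n)) A) (imat_diag d) n m = A n m / d n * d m"
    by (subst imat_mult_def, unfold imat_diag_def, subst suminf_finite[of "{m}"]) auto
  then show ?thesis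
    by (simp add: markov_normalization_def imat_scale_def mult_ac)
qed

text \<open>\<open>X r\<close> plays the role of the r-th power of \<open>A\<close>, and the
  intermediate factors \<open>d k\<close> cancel. For \<open>lam = 0\<close> both sides are 0 at
  every positive power, because division by zero yields 0.\<close>

lemma imat_power_markov_normalization:
  assumes d: "\<And>n. d n \<noteq> 0"
    and zero: "\<And>n m. X 0 n m = of_bool (n = m)"
    and Suc: "\<And>r n m. (\<lambda>k. X r n k * A k m) sums X (Suc r) n m"
  shows "imat_power (markov_normalization lam d A) r n m = d m / d n * (X r n m / lam ^ r)"
proof (induction r arbitrary: m)
  case 0
  then show ?case
    using d by (simp add: imat_diag_def zero)
next
  case (Suc r)
  have "(\<lambda>k. d m / d n / lam ^ Suc r * (X r n k * A k m)) sums
      (d m / d n / lam ^ Suc r * X (Suc r) n m)"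
    by (intro sums_mult assms(3))
  moreover have "d m / d n / lam ^ Suc r * (X r n k * A k m) =
      imat_power (markov_normalization lam d A) r n k * markov_normalization lam d A k m" for k
    using d[of k] by (simp add: Suc markov_normalization_eq mult_ac)
  ultimately show ?case
    by (simp add: imat_mult_def sums_iff)
qed

text \<open>This is the law of total probability: a density with respect to counting measure turns
  the integral into a series.\<close>

lemma pmf_bind_nat:
  fixes N :: "nat pmf"
  shows "pmf (bind_pmf N K) m = (\<Sum>k. pmf N k * pmf (K k) m)"
proof -
  have int: "integrable (measure_pmf N) (\<lambda>k. pmf (K k) m)"
    by (rule measure_pmf.integrable_const_bound[where B = 1]) (auto simp: pmf_le_1)
  have "pmf (bind_pmf N K) m = (\<integral>k. pmf N k * pmf (K k) m \<partial>count_space UNIV)"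
    by (simp add: pmf_bind measure_pmf_eq_density integral_density)
  also have "\<dots> = (\<Sum>k. pmf N k * pmf (K k) m)"
    using int by (intro integral_count_space_nat)
      (simp add: measure_pmf_eq_density integrable_density)
  finally show ?thesis .
qed

text \<open>The last transition is appended by \<open>bind_pmf\<close> and corresponds to the last
  factor on the right in \<open>imat_power\<close>, so both recursions agree.\<close>

lemma pmf_walk_distribution:
  assumes "has_markov_matrix K P"
  shows "pmf (walk_distribution K n r) m = imat_power P r n m"
proof (induction r arbitrary: m)
  case 0
  then show ?case
    by (simp add: imat_diag_def indicator_def)
next
  case (Suc r)
  then show ?case
    using assms by (simp add: pmf_bind_nat imat_mult_def has_markov_matrix_def)
qed


section \<open>The biorthogonal system of a perfect pair\<close>

locale perfect_step_line = step_line p nv for p nv +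
  fixes s :: real and M :: "real measure" and w :: "nat \<Rightarrow> real \<Rightarrow> real"
  assumes weight_moments: "a \<in> {1..p} \<Longrightarrow> integrable M (\<lambda>x. x ^ k * w a x)"
    and perfect: "perfect_system s M p w"
begin

abbreviation \<xi> :: "nat \<Rightarrow> real \<Rightarrow> real" where
  "\<xi> \<equiv> xi p nv w"

definition moment :: "nat \<Rightarrow> nat \<Rightarrow> real" where
  "moment i j = signed_integral s M (\<lambda>x. x ^ i * \<xi> j x)"

lemma integrable_moment: "integrable M (\<lambda>x. x ^ i * \<xi> j x)"
  using weight_moments[OF step_a_mem[of j], of "i + step_k p nv j"]
  by (simp add: xi_def power_add mult.assoc)

lemma signed_integral_sum:
  assumes "\<And>i. i \<in> I \<Longrightarrow> integrable M (f i)"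
  shows "signed_integral s M (\<lambda>x. \<Sum>i\<in>I. c i * f i x) = (\<Sum>i\<in>I. c i * signed_integral s M (f i))"
proof -
  have "(\<integral>x. (\<Sum>i\<in>I. c i * f i x) \<partial>M) = (\<Sum>i\<in>I. c i * (\<integral>x. f i x \<partial>M))"
    using assms by (subst Bochner_Integration.integral_sum) auto
  then show ?thesis
    by (simp add: signed_integral_def sum_distrib_left mult.left_commute)
qed

lemma signed_integral_form:
  "signed_integral s M (\<lambda>x. x ^ i * (\<Sum>j\<in>S. c j * \<xi> j x)) = (\<Sum>j\<in>S. moment i j * c j)"
proof -
  have "x ^ i * (\<Sum>j\<in>S. c j * \<xi> j x) = (\<Sum>j\<in>S. c j * (x ^ i * \<xi> j x))" for x
    by (simp add: sum_distrib_left mult.left_commute)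
  then show ?thesis
    by (simp only: signed_integral_sum[OF integrable_moment] moment_def mult.commute)
qed

lemma poly_mult_xi:
  fixes q :: "real poly"
  assumes "degree q < d"
  shows "poly q x * y = (\<Sum>i<d. coeff q i * (x ^ i * y))"
proof -
  have "(\<Sum>i\<le>degree q. coeff q i * x ^ i) = (\<Sum>i<d. coeff q i * x ^ i)"
  proof (rule sum.mono_neutral_left)
    show "\<forall>i\<in>{..<d} - {..degree q}. coeff q i * x ^ i = 0"
      by (simp add: coeff_eq_0)
  qed (use assms in auto)
  then have "poly q x = (\<Sum>i<d. coeff q i * x ^ i)"
    by (simp only: poly_altdef)
  then show ?thesis
    by (simp only: sum_distrib_right mult.assoc)
qed

lemma integrable_poly_xi: "integrable M (\<lambda>x. poly q x * \<xi> j x)"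
  unfolding poly_mult_xi[OF lessI]
  by (rule Bochner_Integration.integrable_sum, rule integrable_mult_right, rule integrable_moment)

text \<open>The type II conditions thus become a linear system for the transposed moment matrix;
  \<open>signed_integral_form\<close> gives the matrix itself for type I.\<close>

lemma signed_integral_poly_xi:
  assumes "degree q < d"
  shows "signed_integral s M (\<lambda>x. poly q x * \<xi> j x) = (\<Sum>i<d. coeff q i * moment i j)"
  unfolding poly_mult_xi[OF assms] moment_def
  by (rule signed_integral_sum) (rule integrable_moment)

text \<open>A nontrivial kernel vector would solve the orthogonality relations of a multi-index that
  is one larger than the step-line index in a single component, with too small a degree there.\<close>

lemma moment_kernel_trivial:
  assumes ker: "\<forall>i<n. (\<Sum>j<n. moment i j * c j) = 0" and "j0 < n"
  shows "c j0 = 0"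
proof (rule ccontr)
  assume nz: "c j0 \<noteq> 0"
  \<comment> \<open>The combination of the forms \<xi> is grouped by weight: \<open>A a\<close>
    collects the polynomial factor of \<open>w a\<close>.\<close>
  define S where "S a = {j. j \<in> {..<n} \<and> step_a p nv j = a}" for a
  define A where "A a = (\<Sum>j\<in>S a. monom (c j) (step_k p nv j))" for a
  define a0 where "a0 = step_a p nv j0"
  \<comment> \<open>The extra 1 makes the total \<open>n + 1\<close>, so the relations
    \<open>i + 1 < n + 1\<close> are exactly the \<open>n\<close> rows in
    \<open>ker\<close>.\<close>
  define \<nu> where "\<nu> a = card (S a) + of_bool (a = a0)" for a
  have fin: "finite (S a)" for a
    by (simp add: S_def)
  have coeff_A: "coeff (A a) k = (\<Sum>j\<in>S a. if step_k p nv j = k then c j else 0)" for a k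
    by (simp add: A_def coeff_sum)
  have degree_A: "degree (A a) < card (S a)" if "A a \<noteq> 0" for a
  proof -
    have "(\<Sum>j\<in>S a. if step_k p nv j = degree (A a) then c j else 0) \<noteq> 0"
      using that by (simp flip: coeff_A)
    then obtain j where "j \<in> S a" "(if step_k p nv j = degree (A a) then c j else 0) \<noteq> 0"
      by (rule sum.not_neutral_contains_not_neutral)
    then have "j \<in> S a" "step_k p nv j = degree (A a)"
      by (auto split: if_splits)
    then show ?thesis
      using step_k_less_card[of j n] by (auto simp: S_def)
  qed
  have a0: "a0 \<in> {1..p}"
    by (simp only: a0_def step_a_mem)
  \<comment> \<open>An index is determined by its weight and exponent, so \<open>c j0\<close> cannot
    be cancelled by another term.\<close>
  have "coeff (A a0) (step_k p nv j0) = (\<Sum>j\<in>S a0. if j = j0 then c j else 0)"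
    unfolding coeff_A by (intro sum.cong) (auto simp: S_def a0_def dest: step_eqD)
  also have "\<dots> = c j0"
    using fin \<open>j0 < n\<close> by (simp add: S_def a0_def)
  finally have A0: "A a0 \<noteq> 0"
    using nz by auto
  have image: "step_a p nv ` {..<n} \<subseteq> {1..p}"
    using step_a_mem by blast
  have "(\<Sum>a=1..p. card (S a)) = n"
    using sum.group[OF _ _ image, of "\<lambda>_. 1::nat"] by (simp add: S_def)
  then have total: "(\<Sum>a=1..p. \<nu> a) = n + 1"
    using a0 by (simp add: \<nu>_def sum.distrib of_bool_def)
  have form: "(\<Sum>a=1..p. poly (A a) x * w a x) = (\<Sum>j<n. c j * \<xi> j x)" for x
  proof -
    have "poly (A a) x * w a x = (\<Sum>j\<in>S a. c j * \<xi> j x)" for a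
      unfolding A_def poly_sum sum_distrib_right
      by (intro sum.cong) (auto simp: S_def xi_def poly_monom mult.assoc)
    then show ?thesis
      using sum.group[OF _ _ image, of "\<lambda>j. c j * \<xi> j x"] by (simp add: S_def)
  qed
  have normal: "normal_index s M p w \<nu>"
    using perfect by (simp add: perfect_system_def)
  have "\<forall>a\<in>{1..p}. A a \<noteq> 0 \<longrightarrow> degree (A a) < \<nu> a"
    using degree_A by (simp add: \<nu>_def trans_less_add1)
  moreover have "\<forall>i. i + 1 < (\<Sum>a=1..p. \<nu> a) \<longrightarrow>
      signed_integral s M (\<lambda>x. x ^ i * (\<Sum>a=1..p. poly (A a) x * w a x)) = 0"
    unfolding form signed_integral_form total using ker by simp
  moreover have "0 < \<nu> a0"
    by (simp add: \<nu>_def)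
  ultimately have "degree (A a0) + 1 = \<nu> a0"
    using a0 A0 normal[unfolded normal_index_def, THEN spec[of _ A]] by blast
  then show False
    using degree_A[OF A0] by (simp add: \<nu>_def)
qed

text \<open>Every leading section of the moment matrix is invertible. Perfectness enters the later
  arguments only through these inverses.\<close>

lemma moment_inverse:
  obtains h where
    "\<forall>i<n. \<forall>j<n. (\<Sum>k<n. moment i k * h k j) = of_bool (i = j)"
    "\<forall>i<n. \<forall>j<n. (\<Sum>k<n. h i k * moment k j) = of_bool (i = j)"
  using moment_kernel_trivial by (rule inverse_of_trivial_kernel[of n moment])

text \<open>The leading coefficient 1 moves row \<open>l\<close> of the moments to the right-hand
  side and leaves a square system of size \<open>l\<close> for the lower coefficients.\<close>

lemma typeII_unique:
  "\<exists>!B. degree B = l \<and> lead_coeff B = 1 \<and>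
    (\<forall>j<l. signed_integral s M (\<lambda>x. poly B x * \<xi> j x) = 0)"
proof -
  obtain h where "\<forall>i<l. \<forall>j<l. (\<Sum>k<l. moment i k * h k j) = of_bool (i = j)"
    and "\<forall>i<l. \<forall>j<l. (\<Sum>k<l. h i k * moment k j) = of_bool (i = j)"
    by (rule moment_inverse[of l])
  note right = this(1)[rule_format] and left = this(2)[rule_format]
  \<comment> \<open>Transposition reverses products: \<open>left\<close> now serves existence and
    \<open>right\<close> serves uniqueness.\<close>
  have rightT: "(\<Sum>k<l. h k i * moment j k) = of_bool (i = j)" if "i < l" "j < l" for i j
    using right[OF that(2,1)] by (simp add: mult.commute eq_commute)
  have leftT: "(\<Sum>k<l. moment k i * h j k) = of_bool (i = j)" if "i < l" "j < l" for i j
    using left[OF that(2,1)] by (simp add: mult.commute eq_commute)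
  have sys: "signed_integral s M (\<lambda>x. poly B x * \<xi> j x) =
      (\<Sum>i<l. moment i j * coeff B i) + moment l j"
    if "degree B = l" "lead_coeff B = 1" for B j
    using that signed_integral_poly_xi[of B "Suc l" j] by (simp add: mult.commute)
  define b where "b k = (\<Sum>j<l. h j k * - moment l j)" for k
  have b: "(\<Sum>i<l. moment i j * b i) = - moment l j" if "j < l" for j
    unfolding b_def using leftT that
    by (intro solve_of_right_inverse[where g = "\<lambda>i j. moment j i" and h = "\<lambda>i j. h j i"])
  define P where "P = (\<Sum>i<l. monom (b i) i) + monom 1 l"
  have coeff_P: "coeff P i = (if i < l then b i else if i = l then 1 else 0)" for i
    by (auto simp: P_def coeff_sum)
  have "degree P = l"
    by (rule antisym[OF degree_le le_degree]) (simp_all add: coeff_P)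
  then have P: "degree P = l" "lead_coeff P = 1"
    by (simp_all add: coeff_P)
  have "signed_integral s M (\<lambda>x. poly P x * \<xi> j x) = 0" if "j < l" for j
    using b[OF that] by (simp add: sys[OF P] coeff_P)
  then have ex: "degree P = l \<and> lead_coeff P = 1 \<and>
      (\<forall>j<l. signed_integral s M (\<lambda>x. poly P x * \<xi> j x) = 0)"
    using P by blast
  have unique: "coeff B i = (\<Sum>j<l. h j i * - moment l j)"
    if B: "degree B = l" "lead_coeff B = 1"
      "\<forall>j<l. signed_integral s M (\<lambda>x. poly B x * \<xi> j x) = 0" and "i < l" for B i
  proof -
    have "(\<Sum>k<l. moment k j * coeff B k) = - moment l j" if "j < l" for j
      using sys[OF B(1,2), of j] B(3) that by simp
    then have "(\<Sum>j<l. h j i * - moment l j) = (\<Sum>j<l. h j i * (\<Sum>k<l. moment k j * coeff B k))"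
      by (intro sum.cong) auto
    also have "\<dots> = coeff B i"
      using rightT \<open>i < l\<close>
      by (intro solve_of_right_inverse[where g = "\<lambda>i j. h j i" and h = "\<lambda>i j. moment j i"])
    finally show ?thesis by simp
  qed
  show ?thesis
  proof (rule ex1I[of _ P], rule ex)
    fix B assume B: "degree B = l \<and> lead_coeff B = 1 \<and>
      (\<forall>j<l. signed_integral s M (\<lambda>x. poly B x * \<xi> j x) = 0)"
    show "B = P"
    proof (rule poly_eqI)
      fix i show "coeff B i = coeff P i"
      proof (cases "i < l")
        case True
        then show ?thesis
          using B unique by (simp only: coeff_P b_def if_True) blast
      next
        case False
        then show ?thesis
          using B by (auto simp: coeff_P coeff_eq_0)
      qed
    qed
  qed
qed

text \<open>The right-hand side is the last unit vector, so the coefficients form the last column of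
  the inverse of size \<open>Suc l\<close>. Padding by zeros makes the whole function
  unique.\<close>

lemma typeI_unique:
  "\<exists>!c. (\<forall>j>l. c j = 0) \<and>
    (\<forall>i\<le>l. signed_integral s M (\<lambda>x. x ^ i * (\<Sum>j\<le>l. c j * \<xi> j x)) = (if i = l then 1 else 0))"
proof -
  obtain h where "\<forall>i<Suc l. \<forall>j<Suc l. (\<Sum>k<Suc l. moment i k * h k j) = of_bool (i = j)"
    and "\<forall>i<Suc l. \<forall>j<Suc l. (\<Sum>k<Suc l. h i k * moment k j) = of_bool (i = j)"
    by (rule moment_inverse[of "Suc l"])
  note right = this(1)[rule_format] and left = this(2)[rule_format]
  define c where "c j = (if j < Suc l then \<Sum>i<Suc l. h j i * of_bool (i = l) else 0)" for j
  have "(\<Sum>j<Suc l. moment i j * c j) = of_bool (i = l)" if "i < Suc l" for i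
    using solve_of_right_inverse[OF right that, of "\<lambda>i. of_bool (i = l)"] by (simp add: c_def)
  moreover have "d = c" if d: "\<forall>j>l. d j = 0"
      "\<forall>i<Suc l. (\<Sum>j<Suc l. moment i j * d j) = of_bool (i = l)" for d
  proof
    fix j
    show "d j = c j"
    proof (cases "j < Suc l")
      case True
      have "d j = (\<Sum>i<Suc l. h j i * (\<Sum>k<Suc l. moment i k * d k))"
        using solve_of_right_inverse[OF left True, of d] by (rule sym)
      also have "\<dots> = (\<Sum>i<Suc l. h j i * of_bool (i = l))"
        using d(2) by (intro sum.cong) auto
      finally show ?thesis
        using True by (simp add: c_def)
    next
      case False
      then show ?thesis
        using d(1) by (simp add: c_def)
    qed
  qed
  ultimately show ?thesis
    unfolding signed_integral_form
    by (intro ex1I[of _ c]) (auto simp: c_def lessThan_Suc_atMost less_Suc_eq_le of_bool_def)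
qed

section \<open>Biorthogonality of the two families\<close>

abbreviation typeII :: "nat \<Rightarrow> real poly" where
  "typeII \<equiv> typeII_poly s M p nv w"

abbreviation typeI :: "nat \<Rightarrow> real \<Rightarrow> real" where
  "typeI \<equiv> typeI_form s M p nv w w"

lemma typeII:
  "degree (typeII l) = l" "lead_coeff (typeII l) = 1"
  "j < l \<Longrightarrow> signed_integral s M (\<lambda>x. poly (typeII l) x * \<xi> j x) = 0"
  using theI'[OF typeII_unique[of l]] unfolding typeII_poly_def[symmetric] by auto

lemma typeI_eq: "typeI l x = (\<Sum>j\<le>l. typeI_coeff s M p nv w l j * \<xi> j x)"
  by (simp add: typeI_form_def)

lemma typeI:
  assumes "i \<le> l"
  shows "signed_integral s M (\<lambda>x. x ^ i * typeI l x) = of_bool (i = l)"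
  using theI'[OF typeI_unique[of l]] assms
  unfolding typeI_coeff_def[symmetric] typeI_eq[symmetric] by auto

lemma integrable_poly_typeI: "integrable M (\<lambda>x. poly q x * typeI m x)"
proof -
  have "(\<lambda>x. poly q x * typeI m x) =
      (\<lambda>x. \<Sum>j\<le>m. typeI_coeff s M p nv w m j * (poly q x * \<xi> j x))"
    by (simp add: typeI_eq sum_distrib_left mult_ac)
  then show ?thesis
    by (simp add: integrable_poly_xi)
qed

text \<open>For \<open>n \<le> m\<close> expand \<open>typeII n\<close> in powers: only the power
  \<open>m\<close> can survive, with leading coefficient 1. For \<open>n > m\<close> expand
  \<open>typeI m\<close> in the forms \<xi>, each orthogonal to \<open>typeII n\<close>.\<close>

lemma typeII_typeI_biorthogonal:
  "signed_integral s M (\<lambda>x. poly (typeII n) x * typeI m x) = of_bool (n = m)"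
proof (cases "n \<le> m")
  case True
  have int: "integrable M (\<lambda>x. x ^ i * typeI m x)" for i
    using integrable_poly_typeI[of "monom 1 i" m] by (simp add: poly_monom)
  have "signed_integral s M (\<lambda>x. poly (typeII n) x * typeI m x) =
      (\<Sum>i<Suc n. coeff (typeII n) i * signed_integral s M (\<lambda>x. x ^ i * typeI m x))"
    using typeII(1)[of n] signed_integral_sum[OF int]
    by (simp only: poly_mult_xi[of _ "Suc n"] lessI)
  also have "\<dots> = (\<Sum>i<Suc n. coeff (typeII n) i * of_bool (i = m))"
    using True by (intro sum.cong) (auto simp: typeI)
  also have "\<dots> = of_bool (n = m)"
    using True typeII(1,2)[of n] by (auto simp: of_bool_def)
  finally show ?thesis .
next
  case False
  have "signed_integral s M (\<lambda>x. poly (typeII n) x * typeI m x) =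
      signed_integral s M (\<lambda>x. \<Sum>j\<le>m. typeI_coeff s M p nv w m j * (poly (typeII n) x * \<xi> j x))"
    by (simp add: typeI_eq sum_distrib_left mult_ac)
  also have "\<dots> = 0"
    using False by (subst signed_integral_sum) (auto simp: integrable_poly_xi typeII(3))
  finally show ?thesis
    using False by simp
qed

sublocale biorthogonal typeII "\<lambda>q m. signed_integral s M (\<lambda>x. poly q x * typeI m x)"
proof
  fix f g :: "real poly" and m
  show "signed_integral s M (\<lambda>x. poly (f + g) x * typeI m x) =
      signed_integral s M (\<lambda>x. poly f x * typeI m x) + signed_integral s M (\<lambda>x. poly g x * typeI m x)"
    using integrable_poly_typeI[of f m] integrable_poly_typeI[of g m]
    by (simp add: signed_integral_def distrib_left distrib_right)
next
  fix c f m
  show "signed_integral s M (\<lambda>x. poly (Polynomial.smult c f) x * typeI m x) =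
      c * signed_integral s M (\<lambda>x. poly f x * typeI m x)"
    by (simp add: signed_integral_def mult.assoc)
qed (rule typeII typeII_typeI_biorthogonal)+

section \<open>Integral formulas for the matrix powers\<close>

abbreviation spectral :: "real \<Rightarrow> nat \<Rightarrow> nat \<Rightarrow> nat \<Rightarrow> real" where
  "spectral lam r n m \<equiv>
    signed_integral s M (\<lambda>x. x ^ r / lam ^ r * poly (typeII n) x * typeI m x)"

lemma spectral_eq:
  "spectral lam r n m =
    signed_integral s M (\<lambda>x. poly ([:0, 1:] ^ r * typeII n) x * typeI m x) / lam ^ r"
proof -
  have "(\<lambda>x. x ^ r / lam ^ r * poly (typeII n) x * typeI m x) =
      (\<lambda>x. poly ([:0, 1:] ^ r * typeII n) x * typeI m x / lam ^ r)"
    by (simp add: fun_eq_iff)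
  then show ?thesis
    by (simp add: signed_integral_def)
qed

lemma imat_power_typeII:
  assumes "\<And>n. d n \<noteq> 0"
  shows "imat_power (markov_normalization lam d (jacobi_matrix typeII)) r n m =
    d m / d n * spectral lam r n m"
  unfolding spectral_eq
proof (rule imat_power_markov_normalization[OF assms])
  fix r n m
  show "(\<lambda>k. signed_integral s M (\<lambda>x. poly ([:0, 1:] ^ r * typeII n) x * typeI k x) *
      jacobi_matrix typeII k m) sums
    signed_integral s M (\<lambda>x. poly ([:0, 1:] ^ Suc r * typeII n) x * typeI m x)"
    \<comment> \<open>Here \<open>x^r B_n\<close> is expanded and one further factor x is applied to
      each term.\<close>
    using L_mult_sums[of "[:0, 1:] ^ r * typeII n" "[:0, 1:]" m]
    unfolding jacobi_matrix_eq power_Suc mult.assoc .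
qed (simp add: typeII_typeI_biorthogonal)

lemma imat_power_typeI:
  assumes "\<And>n. d n \<noteq> 0"
  shows "imat_power (markov_normalization lam d (imat_transpose (jacobi_matrix typeII))) r n m =
    d m / d n * spectral lam r m n"
  unfolding spectral_eq
proof (rule imat_power_markov_normalization[OF assms])
  fix r n m
  show "(\<lambda>k. signed_integral s M (\<lambda>x. poly ([:0, 1:] ^ r * typeII k) x * typeI n x) *
      imat_transpose (jacobi_matrix typeII) k m) sums
    signed_integral s M (\<lambda>x. poly ([:0, 1:] ^ Suc r * typeII m) x * typeI n x)"
    \<comment> \<open>The transposed entry is J at row \<open>m\<close> and column \<open>k\<close>,
      so \<open>x B_m\<close> is expanded and the factor \<open>x^r\<close> is applied
      afterwards.\<close>
    using L_mult_sums[of "[:0, 1:] * typeII m" "[:0, 1:] ^ r" n]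
    unfolding jacobi_matrix_eq imat_transpose_def power_Suc2 mult.assoc
    by (simp add: mult.commute)
qed (auto simp: typeII_typeI_biorthogonal)

end


section \<open>Evaluation at \<open>\<lambda>\<close>\<close>

text \<open>A zero at \<open>lam\<close> would give |lam| \<le> b \<le> lam for the bound b, so lam
  = b would be an attained bound. With no zeros the bound is -\<infinity> and every
  \<open>lam\<close> is allowed.\<close>

lemma not_zero_above_zero_bound:
  assumes "\<not> zero_bound_attained Z" "zero_bound Z \<le> ereal lam"
  shows "complex_of_real lam \<notin> Z"
proof
  assume Z: "complex_of_real lam \<in> Z"
  then have "ereal \<bar>lam\<bar> \<le> zero_bound Z"
    unfolding zero_bound_def by (intro SUP_upper2[OF Z]) simp
  moreover from this have "\<bar>lam\<bar> \<le> lam"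
    using assms(2) by (meson ereal_less_eq(3) order_trans)
  ultimately have "ereal lam = zero_bound Z"
    using assms(2) by (intro antisym) simp_all
  then show False
    using assms(1) Z by (auto simp: zero_bound_attained_def)
qed

text \<open>At a real point, complex evaluation of a real polynomial agrees with real
  evaluation.\<close>

lemma zeros_typeII_of_real:
  "complex_of_real x \<in> zeros_typeII B \<longleftrightarrow> (\<exists>n. poly (B n) x = 0)"
proof -
  have "poly (map_poly complex_of_real q) (complex_of_real x) = complex_of_real (poly q x)" for q
    by (induction q) (simp_all add: map_poly_pCons)
  then show ?thesis
    by (simp add: zeros_typeII_def)
qed

theorem theorem6:
  fixes \<Delta> :: "real set" and M :: "real measure" and s :: real
    and p :: nat and w :: "nat \<Rightarrow> real \<Rightarrow> real" and wc :: "nat \<Rightarrow> complex \<Rightarrow> complex"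
    and nv :: "nat \<Rightarrow> nat"
    and B :: "nat \<Rightarrow> real poly" and Q :: "nat \<Rightarrow> real \<Rightarrow> real" and Qc :: "nat \<Rightarrow> complex \<Rightarrow> complex"
    and J :: imat
  assumes interval: "is_interval \<Delta>"
    and measure: "finite_measure M" "sets M = sets (restrict_space borel \<Delta>)"
    and sign: "s = 1 \<or> s = -1"
    and support: "infinite (measure_support M)"
    and p: "1 \<le> p"
    and nv: "\<And>a. a \<in> {1..p} \<Longrightarrow> 1 \<le> nv a"
    and weight_sign: "\<And>a. a \<in> {1..p} \<Longrightarrow> constant_sign_on \<Delta> (w a)"
    and weight_moments: "\<And>a k. a \<in> {1..p} \<Longrightarrow> integrable M (\<lambda>x. x ^ k * w a x)"
    and perfect: "perfect_system s M p w"
    and B: "B = typeII_poly s M p nv w"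
    and Q: "Q = typeI_form s M p nv w w"
    and Qc: "Qc = typeI_form s M p nv w wc"
    and J: "J = jacobi_matrix B"
  shows
    "((\<forall>n m. 0 \<le> J n m) \<and>
      zero_bound (zeros_typeII B) < \<infinity> \<and>
      \<not> zero_bound_attained (zeros_typeII B) \<longrightarrow>
      (\<forall>lam::real. zero_bound (zeros_typeII B) \<le> ereal lam \<longrightarrow>
        (let P = markov_normalization lam (\<lambda>n. poly (B n) lam) J in
          \<forall>r n m.
            imat_power P r n m =
              poly (B m) lam / poly (B n) lam *
              signed_integral s M (\<lambda>x. x ^ r / lam ^ r * poly (B n) x * Q m x) \<and>
            (\<forall>K. has_markov_matrix K P \<longrightarrow>
              pmf (walk_distribution K n r) m =
                poly (B m) lam / poly (B n) lam *
                signed_integral s M (\<lambda>x. x ^ r / lam ^ r * poly (B n) x * Q m x)))))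
     \<and>
     ((\<forall>n m. 0 \<le> J n m) \<and>
      zero_bound (zeros_typeI Qc) < \<infinity> \<and>
      \<not> zero_bound_attained (zeros_typeI Qc) \<and>
      (\<forall>a\<in>{1..p}. \<forall>x::real. x \<in> \<Delta> \<or> max (zero_bound (zeros_typeI Qc)) 0 \<le> ereal x \<longrightarrow>
        wc a (complex_of_real x) = complex_of_real (w a x)) \<and>
      (\<forall>n. filterlim (Q n) at_top at_top) \<longrightarrow>
      (\<forall>lam::real. max (zero_bound (zeros_typeI Qc)) 0 \<le> ereal lam \<longrightarrow>
        (let P = markov_normalization lam (\<lambda>n. Q n lam) (imat_transpose J) in
          \<forall>r n m.
            imat_power P r n m =
              Q m lam / Q n lam *
              signed_integral s M (\<lambda>x. x ^ r / lam ^ r * poly (B m) x * Q n x) \<and>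
            (\<forall>K. has_markov_matrix K P \<longrightarrow>
              pmf (walk_distribution K n r) m =
                Q m lam / Q n lam *
                signed_integral s M (\<lambda>x. x ^ r / lam ^ r * poly (B m) x * Q n x)))))"
proof -
  interpret perfect_step_line p nv s M w
    using p nv weight_moments perfect by unfold_locales auto
  show ?thesis
    unfolding Let_def
  proof (intro conjI impI allI; elim conjE)
    fix lam r n m
    assume "\<not> zero_bound_attained (zeros_typeII B)" "zero_bound (zeros_typeII B) \<le> ereal lam"
    then have "poly (B k) lam \<noteq> 0" for k
      using not_zero_above_zero_bound zeros_typeII_of_real by blast
    from imat_power_typeII[of "\<lambda>k. poly (B k) lam", OF this]
    show power: "imat_power (markov_normalization lam (\<lambda>n. poly (B n) lam) J) r n m =
        poly (B m) lam / poly (B n) lam *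
          signed_integral s M (\<lambda>x. x ^ r / lam ^ r * poly (B n) x * Q m x)"
      unfolding J B Q .
    fix K
    assume "has_markov_matrix K (markov_normalization lam (\<lambda>n. poly (B n) lam) J)"
    then show "pmf (walk_distribution K n r) m = poly (B m) lam / poly (B n) lam *
          signed_integral s M (\<lambda>x. x ^ r / lam ^ r * poly (B n) x * Q m x)"
      using power by (simp add: pmf_walk_distribution)
  next
    fix lam r n m
    assume natt: "\<not> zero_bound_attained (zeros_typeI Qc)"
      and lam: "max (zero_bound (zeros_typeI Qc)) 0 \<le> ereal lam"
      and ext: "\<forall>a\<in>{1..p}. \<forall>x::real. x \<in> \<Delta> \<or> max (zero_bound (zeros_typeI Qc)) 0 \<le> ereal x \<longrightarrow>
        wc a (complex_of_real x) = complex_of_real (w a x)"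
    have "Q k lam \<noteq> 0" for k
    proof -
      \<comment> \<open>The zeros concern the complex extension \<open>Qc\<close>, the walk the real
        form \<open>Q\<close>; agreement of the weights at \<open>lam\<close> identifies the two
        values.\<close>
      have "wc (step_a p nv j) (complex_of_real lam) = complex_of_real (w (step_a p nv j) lam)" for j
        using ext lam step_a_mem by blast
      then have "Qc k (complex_of_real lam) = complex_of_real (Q k lam)"
        by (simp add: Q Qc typeI_form_def xi_def scaleR_conv_of_real)
      moreover have "complex_of_real lam \<notin> zeros_typeI Qc"
        using natt lam by (intro not_zero_above_zero_bound) auto
      ultimately show ?thesis
        by (auto simp: zeros_typeI_def)
    qed
    from imat_power_typeI[of "\<lambda>k. Q k lam", OF this]
    show power: "imat_power (markov_normalization lam (\<lambda>n. Q n lam) (imat_transpose J)) r n m =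
        Q m lam / Q n lam *
          signed_integral s M (\<lambda>x. x ^ r / lam ^ r * poly (B m) x * Q n x)"
      unfolding J B Q .
    fix K
    assume "has_markov_matrix K (markov_normalization lam (\<lambda>n. Q n lam) (imat_transpose J))"
    then show "pmf (walk_distribution K n r) m = Q m lam / Q n lam *
          signed_integral s M (\<lambda>x. x ^ r / lam ^ r * poly (B m) x * Q n x)"
      using power by (simp add: pmf_walk_distribution)
  qed
qed

end
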